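(* Let $\mathcal{L}$ be a finite meet-distributive meet-semilattice, $P$ the set of join-irreducible elements of $\mathcal{L}$, $K$ a field, and $K[\mathbf{x}] = K[\{x_p\}_{p\in P}]$ the polynomial ring in $|P|$ variables over $K$. Let $J_{\Gamma_{\mathcal{L}}} \subset K[\mathbf{x}]$ be the ideal generated by the following monomials: (i) $x_p x_q$, where $p,q\in P$ with $p\le q$; (ii) $\prod_{q\in B} x_q$, where $B$ is an antichain of $P$ such that $\langle B\rangle\subset \ell(\alpha)$ for no $\alpha\in\mathcal{L}$; (iii) $x_p\prod_{q\in B}x_q$, where $B$ is an antichain of $P$ such that $\ell(\beta)=\langle B\rangle$ for no $\beta\in\mathcal{L}$, but $\langle B\rangle\subset\ell(\alpha)$ for some $\alpha\in\mathcal{L}$, and where $p\in \ell\bigl(\bigwedge_{\langle B\rangle\subset\ell(\alpha)}\alpha\bigr)\setminus\langle B\rangle$ (the meet being over all $\alpha\in\mathcal{L}$ with $\langle B\rangle\subset\ell(\alpha)$). For $\alpha\in\mathcal{L}$ put $u_\alpha=\prod_{p\in S(\alpha)}x_p$. Then the set of (residue classes of the) monomials $\{u_\alpha : \alpha\in\mathcal{L}\}$ is a $K$-basis of the quotient ring $K[\mathbf{x}]/J_{\Gamma_{\mathcal{L}}}$. Thus in particular $\{S(\alpha) : \alpha\in\mathcal{L}\}$ is a simplicial complex on the vertex set $P$ (identified with $\{x_p : p\in P\}$), whose $f$-vector $(f_{-1},f_0,f_1,\ldots)$ (with $f_{-1}=1$) coincides with the $h$-vector $(h_0,h_1,h_2,\ldots)$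 of the Alexander dual $\Gamma_{\mathcal{L}}$ of $\mathcal{L}$, i.e. $f_{i-1}=h_i$ for all $i$.
   Context: Let $\mathcal{L}$ be a finite meet-semilattice with unique minimal element $\hat 0$. An element $\beta$ is a lower neighbor of $\alpha$ (i.e. $\alpha$ covers $\beta$) if $\beta<\alpha$ and there is no $\gamma$ with $\beta<\gamma<\alpha$; $N(\alpha)$ is the set of lower neighbors of $\alpha$. A join-irreducible element of $\mathcal{L}$ is one that covers exactly one element of $\mathcal{L}$ (so $\hat 0$ is not join-irreducible). $P\subset\mathcal{L}$ is the set of join-irreducible elements with the induced order, and $\ell(\alpha)=\{p\in P : p\le\alpha\}$ for $\alpha\in\mathcal{L}$. $\mathcal{L}$ is called meet-distributive if every interval $[\alpha,\beta]=\{\gamma\in\mathcal{L}:\alpha\le\gamma\le\beta\}$ such that $\alpha$ is the meet of the lower neighbors of $\beta$ in $[\alpha,\beta]$ is a boolean lattice. For $\alpha\in\mathcal{L}$, let $\alpha'$ be the meet of all $\beta\in N(\alpha)$ (with $\hat 0'=\hat 0$), and $S(\alpha)=\ell(\alpha)\setminus\ell(\alpha')\subset P$; thus $S(\hat 0)=\emptyset$ and $u_{\hat 0}=1$. For a subset $B\subset P$, $\langle B\rangle=\{p\in P : p\le q \text{ for some } q\in B\}$ is the poset ideal of $P$ generated by $B$. The Alexander dual $\Gamma_{\mathcal{L}}$ of $\mathcal{L}$ is the simplicial complex on the $2|P|$ vertices $\{x_p,y_p\}_{p\in P}$ whose facets are the sets $F_\alpha=\{x_q : q\in P\setminus\ell(\alpha)\}\cup\{y_q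 : q\in\ell(\alpha)\}$, $\alpha\in\mathcal{L}$. (It is the Alexander dual of the simplicial complex whose Stanley–Reisner ideal is generated by the monomials $\prod_{p\in\ell(\alpha)}x_p\prod_{p\in P\setminus\ell(\alpha)}y_p$, $\alpha\in\mathcal{L}$.) It is pure of dimension $|P|-1$. For a simplicial complex $\Delta$, $f_j$ is the number of faces with $j+1$ elements ($f_{-1}=1$). The $h$-vector of a $(d-1)$-dimensional complex $\Delta$ is defined by $\sum_i h_i\lambda^i=\sum_{i=0}^d f_{i-1}\lambda^i(1-\lambda)^{d-i}$. *)

theory Defs
  imports
    "HOL-Algebra.Embedded_Algebras"
    "HOL-Algebra.QuotRing"
    "HOL-Computational_Algebra.Polynomial"
    "HOL-Library.Poly_Mapping"
begin

section \<open>Finite meet-semilattices\<close>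

text \<open>
  A finite meet-semilattice is a type of class \<open>{finite, semilattice_inf}\<close>. The meet of a
  finite nonempty set is the library's \<open>\<Sqinter>\<^sub>f\<^sub>i\<^sub>n\<close>.
\<close>

definition lower_neighbors :: "'a::order \<Rightarrow> 'a set"
  where "lower_neighbors a = {b. b < a \<and> \<not> (\<exists>c. b < c \<and> c < a)}"

definition join_irreducibles :: "'a::order set"
  where "join_irreducibles = {p. \<exists>!b. b \<in> lower_neighbors p}"

definition ell :: "'a::order \<Rightarrow> 'a set"
  where "ell a = {p \<in> join_irreducibles. p \<le> a}"

definition boolean_lattice_on :: "'a::order set \<Rightarrow> bool"
  where "boolean_lattice_on A \<longleftrightarrow>
    (\<exists>(n::nat) f. bij_betw f A (Pow {..<n}) \<and> (\<forall>x\<in>A. \<forall>y\<in>A. x \<le> y \<longleftrightarrow> f x \<subseteq> f y))"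

text \<open>
  Inserting \<open>b\<close> into a set of elements below \<open>b\<close> changes its meet only if the set is empty,
  in which case the meet is \<open>b\<close>, the greatest element of \<open>{a..b}\<close>. Because intervals are convex,
  the lower neighbors of \<open>b\<close> in the poset \<open>{a..b}\<close> are those of \<open>b\<close> that lie in \<open>{a..b}\<close>.
\<close>

definition meet_distributive :: "'a::{finite, semilattice_inf} itself \<Rightarrow> bool"
  where "meet_distributive _ \<longleftrightarrow>
    (\<forall>a b::'a. a \<le> b \<longrightarrow> a = \<Sqinter>\<^sub>f\<^sub>i\<^sub>n (insert b (lower_neighbors b \<inter> {a..b})) \<longrightarrow>
       boolean_lattice_on {a..b})"

text \<open>Inserting \<open>a\<close> has an effect only for the least element, whose prime is itself.\<close>

definition meet_prime :: "'a::{finite, semilattice_inf} \<Rightarrow> 'a"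
  where "meet_prime a = \<Sqinter>\<^sub>f\<^sub>i\<^sub>n (insert a (lower_neighbors a))"

definition S :: "'a::{finite, semilattice_inf} \<Rightarrow> 'a set"
  where "S a = ell a - ell (meet_prime a)"

definition poset_ideal :: "'a::order set \<Rightarrow> 'a set"
  where "poset_ideal B = {p \<in> join_irreducibles. \<exists>q\<in>B. p \<le> q}"

definition antichain :: "'a::order set \<Rightarrow> bool"
  where "antichain B \<longleftrightarrow> (\<forall>p\<in>B. \<forall>q\<in>B. p \<le> q \<longrightarrow> p = q)"


section \<open>Simplicial complexes\<close>

definition simplicial_complex_on :: "'v set \<Rightarrow> 'v set set \<Rightarrow> bool"
  where "simplicial_complex_on V \<Delta> \<longleftrightarrow>
    finite V \<and> \<Delta> \<subseteq> Pow V \<and> {} \<in> \<Delta> \<and> (\<forall>v\<in>V. {v} \<in> \<Delta>) \<and> (\<forall>F\<in>\<Delta>. \<forall>G. G \<subseteq> F \<longrightarrow> G \<in> \<Delta>)"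

text \<open>The index is shifted: \<open>f_number \<Delta> i\<close> is $f_{i-1}$.\<close>

definition f_number :: "'v set set \<Rightarrow> nat \<Rightarrow> nat"
  where "f_number \<Delta> i = card {F \<in> \<Delta>. card F = i}"

definition dim_plus_one :: "'v set set \<Rightarrow> nat"
  where "dim_plus_one \<Delta> = Max (card ` \<Delta>)"

text \<open>The polynomial \<open>[:1, -1:]\<close> is $1 - \lambda$.\<close>

definition h_number :: "'v set set \<Rightarrow> nat \<Rightarrow> int"
  where "h_number \<Delta> i =
    coeff (\<Sum>j\<le>dim_plus_one \<Delta>.
      monom (int (f_number \<Delta> j)) j * [:1, -1:] ^ (dim_plus_one \<Delta> - j)) i"

text \<open>The vertices $x_p$ and $y_p$ are \<open>Inl p\<close> and \<open>Inr p\<close>.\<close>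

definition dual_facet :: "'a::order \<Rightarrow> ('a + 'a) set"
  where "dual_facet a = Inl ` (join_irreducibles - ell a) \<union> Inr ` ell a"

definition alexander_dual :: "('a::order + 'a) set set"
  where "alexander_dual = {F. \<exists>a. F \<subseteq> dual_facet a}"


section \<open>Polynomial rings and the ideal\<close>

text \<open>
  A polynomial maps finitely many exponent vectors to nonzero coefficients; the multiplication
  that \<^theory>\<open>HOL-Library.Poly_Mapping\<close> provides on this type is convolution.
\<close>

type_synonym ('v, 'k) mpoly = "('v \<Rightarrow>\<^sub>0 nat) \<Rightarrow>\<^sub>0 'k"

definition const :: "'k::zero \<Rightarrow> ('v, 'k) mpoly"
  where "const c = Poly_Mapping.single 0 c"

definition var :: "'v \<Rightarrow> ('v, 'k::zero_neq_one) mpoly"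
  where "var v = Poly_Mapping.single (Poly_Mapping.single v 1) 1"

definition poly_ring :: "'v set \<Rightarrow> ('v, 'k::comm_ring_1) mpoly ring"
  where "poly_ring V =
    \<lparr>carrier = {f. \<forall>m \<in> Poly_Mapping.keys f. Poly_Mapping.keys m \<subseteq> V},
     monoid.mult = (*), one = 1, zero = 0, add = (+)\<rparr>"

lemma poly_ring_cring: "cring (poly_ring V :: ('v, 'k::comm_ring_1) mpoly ring)"
proof -
  let ?R = "poly_ring V :: ('v, 'k) mpoly ring"
  have carrier: "f \<in> carrier ?R \<longleftrightarrow> (\<forall>m \<in> Poly_Mapping.keys f. Poly_Mapping.keys m \<subseteq> V)" for f
    by (simp add: poly_ring_def)
  have ops: "f \<oplus>\<^bsub>?R\<^esub> g = f + g" "f \<otimes>\<^bsub>?R\<^esub> g = f * g" "\<zero>\<^bsub>?R\<^esub> = 0" "\<one>\<^bsub>?R\<^esub> = 1" for f g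
    by (simp_all add: poly_ring_def)
  have add: "f + g \<in> carrier ?R" if "f \<in> carrier ?R" "g \<in> carrier ?R" for f g
    using that Poly_Mapping.keys_add[of f g] unfolding carrier by blast
  have neg: "- f \<in> carrier ?R" if "f \<in> carrier ?R" for f
    using that unfolding carrier by simp
  have mult: "f * g \<in> carrier ?R" if f: "f \<in> carrier ?R" and g: "g \<in> carrier ?R" for f g
    unfolding carrier
  proof
    fix m assume "m \<in> Poly_Mapping.keys (f * g)"
    then obtain a b where "a \<in> Poly_Mapping.keys f" "b \<in> Poly_Mapping.keys g" "m = a + b"
      using Poly_Mapping.keys_mult[of f g] by blast
    then show "Poly_Mapping.keys m \<subseteq> V"
      using f g Poly_Mapping.keys_add[of a b] unfolding carrier by blast
  qed
  have zero: "0 \<in> carrier ?R" and one: "1 \<in> carrier ?R"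
    unfolding carrier by simp_all
  show ?thesis
  proof (rule cringI)
    show "abelian_group ?R"
    proof (rule abelian_groupI)
      fix f assume "f \<in> carrier ?R"
      then show "\<exists>g\<in>carrier ?R. g \<oplus>\<^bsub>?R\<^esub> f = \<zero>\<^bsub>?R\<^esub>"
        using neg by (intro bexI[of _ "- f"]) (simp_all add: ops)
    qed (simp_all add: ops add zero ac_simps)
    show "Group.comm_monoid ?R"
      by (rule comm_monoidI) (simp_all add: ops mult one ac_simps)
  qed (simp add: ops distrib_right)
qed

definition gens_order :: "('a::{finite, semilattice_inf}, 'k::field) mpoly set"
  where "gens_order =
    {var p * var q | p q. p \<in> join_irreducibles \<and> q \<in> join_irreducibles \<and> p \<le> q}"

definition gens_unbounded :: "('a::{finite, semilattice_inf}, 'k::field) mpoly set"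
  where "gens_unbounded =
    {\<Prod>q\<in>B. var q | B. B \<subseteq> join_irreducibles \<and> antichain B \<and> \<not> (\<exists>a. poset_ideal B \<subseteq> ell a)}"

definition gens_closure :: "('a::{finite, semilattice_inf}, 'k::field) mpoly set"
  where "gens_closure =
    {var p * (\<Prod>q\<in>B. var q) | p B. B \<subseteq> join_irreducibles \<and> antichain B \<and>
       \<not> (\<exists>b. ell b = poset_ideal B) \<and> (\<exists>a. poset_ideal B \<subseteq> ell a) \<and>
       p \<in> ell (\<Sqinter>\<^sub>f\<^sub>i\<^sub>n {a. poset_ideal B \<subseteq> ell a}) - poset_ideal B}"

definition J_ideal :: "('a::{finite, semilattice_inf}, 'k::field) mpoly set"
  where "J_ideal = Idl\<^bsub>poly_ring join_irreducibles\<^esub> (gens_order \<union> gens_unbounded \<union> gens_closure)"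

definition quotient_ring :: "('a::{finite, semilattice_inf}, 'k::field) mpoly set ring"
  where "quotient_ring = poly_ring join_irreducibles Quot J_ideal"

definition residue_class ::
    "('a::{finite, semilattice_inf}, 'k::field) mpoly \<Rightarrow> ('a, 'k) mpoly set"
  where "residue_class f = J_ideal +>\<^bsub>poly_ring join_irreducibles\<^esub> f"

text \<open>The field $K$ acts on the quotient ring through the residue classes of the constants.\<close>

definition scalars :: "('a::{finite, semilattice_inf}, 'k::field) mpoly set set"
  where "scalars = residue_class ` range const"

definition u :: "'a::{finite, semilattice_inf} \<Rightarrow> ('a, 'k::field) mpoly"
  where "u a = (\<Prod>p\<in>S a. var p)"

definition is_finite_basis :: "('r, 'm) ring_scheme \<Rightarrow> 'r set \<Rightarrow> 'r set \<Rightarrow> bool"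
  where "is_finite_basis R K B \<longleftrightarrow>
    (\<exists>Us. distinct Us \<and> set Us = B \<and> ring.independent R K Us \<and> ring.Span R K Us = carrier R)"

end

theory Submission
  imports Defs
begin

text \<open>
  In a meet-distributive semilattice the sets \<open>ell a\<close> are the closed sets of a convex geometry on
  the join-irreducibles whose extreme points are \<open>S a\<close>: booleanness of the interval from
  \<open>meet_prime a\<close> to \<open>a\<close> shows that \<open>ell a\<close> loses exactly one point on passing to a lower
  neighbor. Hence a set \<open>B\<close> of join-irreducibles has join \<open>a\<close> iff \<open>S a \<subseteq> B \<subseteq> ell a\<close>, and the
  sets \<open>S a\<close> are the bounded sets in which no point lies below the join of the others.

  This second description says that the monomials divisible by no generator are exactly the
  \<open>u a\<close>, so the ideal consists of the polynomials without a term \<open>u a\<close>, and the \<open>u a\<close> form a basis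
  of the quotient. The first one partitions the faces of the Alexander dual into intervals with
  lower ends of size \<open>card (S a)\<close> and with facets as upper ends; such an interval contributes
  $\lambda^{|S(a)|}$ to the h-polynomial.
\<close>

section \<open>Meet-distributive semilattices\<close>

lemma lower_neighbors_less: "b \<in> lower_neighbors a \<Longrightarrow> b < a"
  by (simp add: lower_neighbors_def)

lemma lower_neighbors_eqI:
  assumes "b \<in> lower_neighbors a" "b \<le> x" "x < a"
  shows "x = b"
  using assms by (auto simp: lower_neighbors_def order.order_iff_strict)

lemma less_imp_le_lower_neighbor:
  fixes x :: "'a::{finite, order}"
  assumes "x < y"
  shows "\<exists>b\<in>lower_neighbors y. x \<le> b"
proof -
  obtain b where b: "b \<in> {z. x \<le> z \<and> z < y}" "\<forall>z\<in>{z. x \<le> z \<and> z < y}. b \<le> z \<longrightarrow> b = z"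
    using finite_has_maximal2[of "{z. x \<le> z \<and> z < y}" x] assms by auto
  then have "b \<in> lower_neighbors y"
    unfolding lower_neighbors_def
    by clarsimp (metis less_le_not_le order_trans)
  with b show ?thesis by blast
qed

text \<open>By finiteness everything strictly below \<open>p\<close> lies under a lower neighbor,
  and there is only one.\<close>

lemma join_irreducible_below:
  fixes p :: "'a::{finite, order}"
  assumes "p \<in> join_irreducibles"
  obtains b where "lower_neighbors p = {b}" "\<And>x. x < p \<Longrightarrow> x \<le> b"
proof -
  obtain b where b: "lower_neighbors p = {b}"
    using assms unfolding join_irreducibles_def by blast
  moreover have "x \<le> b" if "x < p" for x
    using less_imp_le_lower_neighbor[OF that] b by simp
  ultimately show ?thesis using that by blast
qed

lemma join_irreducibleI:
  fixes c :: "'a::{finite, order}"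
  assumes "b < c" "\<And>x. x < c \<Longrightarrow> x \<le> b"
  shows "c \<in> join_irreducibles"
proof -
  have "b \<in> lower_neighbors c" and "\<And>x. x \<in> lower_neighbors c \<Longrightarrow> x = b"
    using assms unfolding lower_neighbors_def by (auto dest!: leD)
      (metis assms(2) order.order_iff_strict)
  then show ?thesis unfolding join_irreducibles_def by blast
qed

lemma ell_mono: "a \<le> b \<Longrightarrow> ell a \<subseteq> ell b"
  unfolding ell_def by auto

lemma ell_subset: "ell a \<subseteq> join_irreducibles"
  unfolding ell_def by auto

text \<open>A minimal element among those below \<open>a\<close> but not below \<open>b\<close> is join-irreducible, because
  everything strictly below it lies below its meet with \<open>b\<close>.\<close>

lemma ex_join_irreducible:
  fixes a b :: "'a::{finite, semilattice_inf}"
  assumes "\<not> a \<le> b"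
  shows "\<exists>p\<in>ell a. \<not> p \<le> b"
proof -
  obtain c where c: "c \<in> {x. x \<le> a \<and> \<not> x \<le> b}"
      "\<forall>x\<in>{x. x \<le> a \<and> \<not> x \<le> b}. x \<le> c \<longrightarrow> c = x"
    using finite_has_minimal2[of "{x. x \<le> a \<and> \<not> x \<le> b}" a] assms by auto
  have "c \<in> join_irreducibles"
  proof (rule join_irreducibleI[of "inf b c"])
    show "inf b c < c"
      using c by (metis inf.cobounded1 inf.cobounded2 mem_Collect_eq order.not_eq_order_implies_strict)
    show "x \<le> inf b c" if "x < c" for x
      using that c by (auto simp: less_le_not_le dest: order_trans)
  qed
  with c show ?thesis unfolding ell_def by auto
qed

lemma ell_subset_iff: "ell a \<subseteq> ell b \<longleftrightarrow> a \<le> (b::'a::{finite, semilattice_inf})"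
  using ex_join_irreducible[of a b] ell_mono[of a b] unfolding ell_def by blast

section \<open>The meet of the lower neighbors and the points it loses\<close>

lemma meet_prime_le_lower_neighbor: "b \<in> lower_neighbors a \<Longrightarrow> meet_prime a \<le> b"
  unfolding meet_prime_def by (rule Inf_fin.coboundedI) auto

lemma meet_prime_le: "meet_prime a \<le> a"
  unfolding meet_prime_def by (rule Inf_fin.coboundedI) auto

lemma le_meet_prime: "x \<le> a \<Longrightarrow> (\<And>b. b \<in> lower_neighbors a \<Longrightarrow> x \<le> b) \<Longrightarrow> x \<le> meet_prime a"
  unfolding meet_prime_def by (rule Inf_fin.boundedI) auto

text \<open>Lying below a meet means lying below each of its members, so \<open>S a\<close> collects
  the points that at least one lower neighbor of \<open>a\<close> loses.\<close>

lemma S_iff: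
  "p \<in> S a \<longleftrightarrow> p \<in> ell a \<and> (\<exists>b\<in>lower_neighbors a. \<not> p \<le> b)"
  using meet_prime_le_lower_neighbor[of _ a] le_meet_prime[of p a] order_trans
  unfolding S_def ell_def by blast

lemma S_subset_ell: "S a \<subseteq> ell a"
  unfolding S_def by blast

section \<open>Boolean intervals and their coatoms\<close>

lemma lower_neighbors_interval: "b \<in> lower_neighbors a \<Longrightarrow> b \<in> {meet_prime a..a}"
  using meet_prime_le_lower_neighbor[of b a] lower_neighbors_less[of b a] by (simp add: less_imp_le)

text \<open>All lower neighbors of \<open>a\<close> lie in this interval, so its lower end is the
  meet that the definition of meet-distributivity asks for.\<close>

lemma boolean_interval:
  assumes "meet_distributive TYPE('a::{finite, semilattice_inf})"
  shows "boolean_lattice_on {meet_prime a..a::'a}"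
proof -
  have "lower_neighbors a \<inter> {meet_prime a..a} = lower_neighbors a"
    using lower_neighbors_interval by blast
  then show ?thesis
    using assms meet_prime_le[of a] unfolding meet_distributive_def meet_prime_def by metis
qed

text \<open>An isomorphism onto a power set sends the top to the full set, hence the lower neighbors
  of the top to complements of single points.\<close>

lemma boolean_coatoms:
  assumes "boolean_lattice_on {meet_prime a..a::'a::{finite, semilattice_inf}}"
  obtains n f where "bij_betw f {meet_prime a..a} (Pow {..<n::nat})"
    "\<And>x y. x \<in> {meet_prime a..a} \<Longrightarrow> y \<in> {meet_prime a..a} \<Longrightarrow> x \<le> y \<longleftrightarrow> f x \<subseteq> f y"
    "\<And>b. b \<in> lower_neighbors a \<Longrightarrow> \<exists>i<n. f b = {..<n} - {i}"
proof -
  let ?I = "{meet_prime a..a}"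
  obtain n f where bij: "bij_betw f ?I (Pow {..<n::nat})"
    and le: "\<And>x y. x \<in> ?I \<Longrightarrow> y \<in> ?I \<Longrightarrow> x \<le> y \<longleftrightarrow> f x \<subseteq> f y"
    using assms unfolding boolean_lattice_on_def by blast
  have surj: "\<exists>x\<in>?I. f x = X" if "X \<subseteq> {..<n}" for X
    using bij that unfolding bij_betw_def by (metis Pow_iff imageE)
  have sub: "f x \<subseteq> {..<n}" if "x \<in> ?I" for x
    using bij that unfolding bij_betw_def by blast
  have inj: "x = y" if "x \<in> ?I" "y \<in> ?I" "f x = f y" for x y
    using bij that unfolding bij_betw_def inj_on_def by blast
  have top: "f a = {..<n}"
  proof -
    obtain x where x: "x \<in> ?I" "f x = {..<n}" using surj by blast
    then show ?thesis using le[of x a] meet_prime_le[of a] sub[of a] by auto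
  qed
  have "\<exists>i<n. f b = {..<n} - {i}" if b: "b \<in> lower_neighbors a" for b
  proof -
    have bI: "b \<in> ?I" and ab: "b < a" and aI: "a \<in> ?I"
      using lower_neighbors_interval[OF b] lower_neighbors_less[OF b] meet_prime_le[of a] by simp_all
    have "f b \<noteq> {..<n}" using inj[OF bI aI] top ab by auto
    then obtain i where i: "i < n" "i \<notin> f b" using sub[OF bI] by blast
    \<comment> \<open>The element representing the complement of \<open>i\<close> lies between
      \<open>b\<close> and \<open>a\<close>, so covering forces it to be \<open>b\<close>.\<close>
    obtain x where x: "x \<in> ?I" "f x = {..<n} - {i}" using surj[of "{..<n} - {i}"] by blast
    have "b \<le> x" using le[OF bI x(1)] x(2) i sub[OF bI] by auto
    moreover have "x < a"
    proof -
      have "f x \<noteq> f a" using x(2) i(1) top by blast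
      then show ?thesis using x(1) by (cases "x = a") auto
    qed
    ultimately have "x = b" using lower_neighbors_eqI b by metis
    with x i show ?thesis by blast
  qed
  with bij le that show ?thesis by blast
qed

text \<open>Two distinct coatoms of a power set meet in a set one point smaller than either. The
  meet of \<open>b\<close> and \<open>d\<close>, and everything between it and \<open>d\<close>,
  stays inside the interval.\<close>

lemma inf_lower_neighbors:
  assumes "boolean_lattice_on {meet_prime a..a::'a::{finite, semilattice_inf}}"
    and b: "b \<in> lower_neighbors a" and d: "d \<in> lower_neighbors a" and "b \<noteq> d"
  shows "inf b d \<in> lower_neighbors d"
proof -
  let ?I = "{meet_prime a..a}"
  obtain n f where bij: "bij_betw f ?I (Pow {..<n::nat})"
    and le: "\<And>x y. x \<in> ?I \<Longrightarrow> y \<in> ?I \<Longrightarrow> x \<le> y \<longleftrightarrow> f x \<subseteq> f y"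
    and co: "\<And>b. b \<in> lower_neighbors a \<Longrightarrow> \<exists>i<n. f b = {..<n} - {i}"
    using boolean_coatoms[OF assms(1)] by metis
  have I: "b \<in> ?I" "d \<in> ?I"
    using b d lower_neighbors_interval by blast+
  obtain i j where i: "i < n" "f b = {..<n} - {i}" and j: "j < n" "f d = {..<n} - {j}"
    using co b d by metis
  have "inf b d < d"
    using lower_neighbors_eqI[OF d, of b] \<open>b \<noteq> d\<close> lower_neighbors_less[OF b]
    by (metis inf.cobounded2 inf.orderI inf_commute order.not_eq_order_implies_strict)
  moreover have False if c: "inf b d < c" "c < d" for c
  proof -
    have mI: "inf b d \<in> ?I" using I by (auto intro: le_infI1 le_infI2)
    have cI: "c \<in> ?I"
      using order_trans[of "meet_prime a" "inf b d" c] order_trans[of c d a] mI I(2) c by simp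
    \<comment> \<open>This set is at most one point smaller than \<open>f d\<close>, and its
      preimage lies below \<open>inf b d\<close>; a strict chain from \<open>inf b d\<close> through
      \<open>c\<close> to \<open>d\<close> would need two points.\<close>
    have "{..<n} - {i} - {j} \<in> f ` ?I" using bij unfolding bij_betw_def by auto
    then obtain x where x: "x \<in> ?I" "f x = {..<n} - {i} - {j}" by (metis imageE)
    have "x \<le> b" "x \<le> d" using le[OF x(1) I(1)] le[OF x(1) I(2)] x i j by auto
    then have "x \<le> inf b d" by simp
    then have "f x \<subseteq> f (inf b d)" "f (inf b d) \<subseteq> f c" "f c \<subseteq> f d"
      "\<not> f c \<subseteq> f (inf b d)" "\<not> f d \<subseteq> f c"
      using le[OF x(1) mI] le[OF mI cI] le[OF cI mI] le[OF cI I(2)] le[OF I(2) cI] c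
      by (auto simp: less_le_not_le)
    then show False unfolding x j by blast
  qed
  ultimately show ?thesis unfolding lower_neighbors_def by blast
qed

text \<open>The coatom \<open>b\<close> omits a point that \<open>d\<close> and \<open>e\<close>
  both contain, so the element omitting only what \<open>d\<close> and \<open>e\<close> omit is not
  below \<open>b\<close>. The case \<open>d = e\<close> is included.\<close>

lemma inf_lower_neighbors_not_le:
  assumes "boolean_lattice_on {meet_prime a..a::'a::{finite, semilattice_inf}}"
    and b: "b \<in> lower_neighbors a" and d: "d \<in> lower_neighbors a" and e: "e \<in> lower_neighbors a"
    and "b \<noteq> d" "b \<noteq> e"
  shows "\<not> inf d e \<le> b"
proof
  assume "inf d e \<le> b"
  let ?I = "{meet_prime a..a}"
  obtain n f where bij: "bij_betw f ?I (Pow {..<n::nat})"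
    and le: "\<And>x y. x \<in> ?I \<Longrightarrow> y \<in> ?I \<Longrightarrow> x \<le> y \<longleftrightarrow> f x \<subseteq> f y"
    and co: "\<And>b. b \<in> lower_neighbors a \<Longrightarrow> \<exists>i<n. f b = {..<n} - {i}"
    using boolean_coatoms[OF assms(1)] by metis
  have I: "b \<in> ?I" "d \<in> ?I" "e \<in> ?I"
    using b d e lower_neighbors_interval by blast+
  obtain i j k where i: "i < n" "f b = {..<n} - {i}" and j: "j < n" "f d = {..<n} - {j}"
    and k: "k < n" "f e = {..<n} - {k}"
    using co b d e by metis
  have "f b \<noteq> f d" "f b \<noteq> f e" using bij I assms(5,6) unfolding bij_betw_def inj_on_def by blast+
  then have "i \<noteq> j" "i \<noteq> k" using i j k by auto
  have "{..<n} - {j} - {k} \<in> f ` ?I" using bij unfolding bij_betw_def by auto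
  then obtain x where x: "x \<in> ?I" "f x = {..<n} - {j} - {k}" by (metis imageE)
  have "x \<le> d" "x \<le> e" using le[OF x(1) I(2)] le[OF x(1) I(3)] x k j by auto
  then have "x \<le> b" using \<open>inf d e \<le> b\<close> by (meson le_inf_iff order_trans)
  then have "f x \<subseteq> f b" using le x I by blast
  then show False using x i \<open>i \<noteq> j\<close> \<open>i \<noteq> k\<close> by auto
qed

text \<open>Induction on the number of elements below \<open>a\<close>: two lost points
  \<open>p\<close> and \<open>q\<close> lie under coatoms \<open>d\<close> and \<open>e\<close>, and
  both agree with a third lost point found under \<open>inf d e\<close>.\<close>

lemma ell_lower_neighbor_unique:
  assumes md: "meet_distributive TYPE('a::{finite, semilattice_inf})"
  shows "\<lbrakk>b \<in> lower_neighbors (a::'a); p \<in> ell a; \<not> p \<le> b; q \<in> ell a; \<not> q \<le> b\<rbrakk> \<Longrightarrow> p = q"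
proof (induction "card {x. x < a}" arbitrary: a b p q rule: less_induct)
  case less
  note bool = boolean_interval[OF md, of a]
  \<comment> \<open>If \<open>a\<close> is itself join-irreducible, then \<open>b\<close> is its
    only lower neighbor, and the only element up to \<open>a\<close> that is not below
    \<open>b\<close> is \<open>a\<close>.\<close>
  have top: "q' = p'"
    if "p' = a" "p' \<in> join_irreducibles" "q' \<le> a" "\<not> q' \<le> b" for p' q'
    using join_irreducible_below[OF that(2)] less.prems(1) that
    by (metis order.order_iff_strict singletonD)
  \<comment> \<open>A point below \<open>d\<close> lies below \<open>b\<close> iff it lies below
    \<open>inf b d\<close>, a lower neighbor of \<open>d\<close>; so the induction hypothesis
    applies to \<open>d\<close>.\<close>
  have step: "p' = q'" if d: "d \<in> lower_neighbors a" "d \<noteq> b"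
    and "p' \<in> ell d" "\<not> p' \<le> b" "q' \<in> ell d" "\<not> q' \<le> b" for d p' q'
  proof (rule less.hyps)
    show "card {x. x < d} < card {x. x < a}"
      using lower_neighbors_less[OF d(1)] by (intro psubset_card_mono) (auto dest: order_less_trans)
    show "inf b d \<in> lower_neighbors d" using inf_lower_neighbors[OF bool] less.prems(1) d by blast
  qed (use that in auto)
  show ?case
  proof (cases "p = a \<or> q = a")
    case True
    then show ?thesis using top less.prems unfolding ell_def by auto
  next
    case False
    then have "p < a" "q < a" using less.prems unfolding ell_def by auto
    then obtain d e where d: "d \<in> lower_neighbors a" "p \<le> d" and e: "e \<in> lower_neighbors a" "q \<le> e"
      using less_imp_le_lower_neighbor by metis
    then have ne: "b \<noteq> d" "b \<noteq> e" using less.prems by auto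
    obtain r where r: "r \<in> ell (inf d e)" "\<not> r \<le> b"
      using ex_join_irreducible inf_lower_neighbors_not_le[OF bool less.prems(1) d(1) e(1) ne] by blast
    have "p = r" using step[OF d(1), of p r] ne d less.prems r unfolding ell_def by auto
    moreover have "q = r" using step[OF e(1), of q r] ne e less.prems r unfolding ell_def by auto
    ultimately show ?thesis by simp
  qed
qed

text \<open>A lower neighbor that loses \<open>p\<close> loses no other point. So deleting a point
  of \<open>S a\<close> from \<open>ell a\<close> leaves a set of the same form, which makes it an
  extreme point.\<close>

lemma S_imp_lower_neighbor:
  assumes "meet_distributive TYPE('a::{finite, semilattice_inf})" and "p \<in> S (a::'a)"
  obtains b where "b \<in> lower_neighbors a" "ell b = ell a - {p}"
proof -
  obtain b where b: "b \<in> lower_neighbors a" "\<not> p \<le> b" "p \<in> ell a"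
    using assms(2) unfolding S_iff by blast
  have "q = p" if "q \<in> ell a" "q \<notin> ell b" for q
    using ell_lower_neighbor_unique[OF assms(1) b(1), of p q] b that unfolding ell_def by blast
  moreover have "ell b \<subseteq> ell a" using b lower_neighbors_less ell_mono less_imp_le by blast
  moreover have "p \<notin> ell b" using b unfolding ell_def by simp
  ultimately have "ell b = ell a - {p}" by blast
  with b(1) that show ?thesis by blast
qed

section \<open>Joins of bounded sets of join-irreducibles\<close>

definition join_of :: "'a::{finite, semilattice_inf} set \<Rightarrow> 'a"
  where "join_of B = \<Sqinter>\<^sub>f\<^sub>i\<^sub>n {a. B \<subseteq> ell a}"

lemma join_of_le: "B \<subseteq> ell a \<Longrightarrow> join_of B \<le> a"
  unfolding join_of_def by (rule Inf_fin.coboundedI) auto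

text \<open>Without a bound the meet defining \<open>join_of B\<close> runs over the empty set and
  its value is unspecified; hence the hypothesis.\<close>

lemma subset_ell_join_of:
  assumes "B \<subseteq> ell a" shows "B \<subseteq> ell (join_of B)"
proof
  fix p assume "p \<in> B"
  then have "p \<le> join_of B"
    unfolding join_of_def using assms
    by (intro Inf_fin.boundedI) (auto simp: ell_def)
  with \<open>p \<in> B\<close> assms show "p \<in> ell (join_of B)" unfolding ell_def by auto
qed

text \<open>A smaller join would lie below some lower neighbor of \<open>a\<close>, but every lower
  neighbor misses a point of \<open>S a\<close>, which \<open>B\<close> contains.\<close>

lemma join_of_eqI:
  assumes "S a \<subseteq> B" "B \<subseteq> ell a"
  shows "join_of B = a"
proof (rule ccontr)
  assume ne: "join_of B \<noteq> a"
  have "join_of B \<le> a" by (rule join_of_le[OF assms(2)])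
  with ne obtain b where b: "b \<in> lower_neighbors a" "join_of B \<le> b"
    using less_imp_le_lower_neighbor[of "join_of B" a] order.not_eq_order_implies_strict by blast
  obtain p where p: "p \<in> ell a" "\<not> p \<le> b"
    using ex_join_irreducible[of a b] lower_neighbors_less[OF b(1)] by (auto dest: leD)
  then have "p \<in> S a" using b unfolding S_iff by blast
  then have "p \<in> ell (join_of B)" using assms subset_ell_join_of by blast
  then show False using p b unfolding ell_def by auto
qed

text \<open>Were a point of \<open>S (join_of B)\<close> missing from \<open>B\<close>, deleting it
  from \<open>ell (join_of B)\<close> would leave a set \<open>ell b\<close> that still contains
  \<open>B\<close>, with \<open>b\<close> strictly below the join.\<close>

lemma S_subset_of_join_of:
  assumes "meet_distributive TYPE('a::{finite, semilattice_inf})"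
    and "B \<subseteq> ell (a::'a)"
  shows "S (join_of B) \<subseteq> B"
proof
  fix p assume p: "p \<in> S (join_of B)"
  obtain b where b: "b \<in> lower_neighbors (join_of B)" "ell b = ell (join_of B) - {p}"
    using S_imp_lower_neighbor[OF assms(1) p] .
  show "p \<in> B"
  proof (rule ccontr)
    assume "p \<notin> B"
    then have "B \<subseteq> ell b" using b subset_ell_join_of[OF assms(2)] by blast
    then show False using join_of_le lower_neighbors_less[OF b(1)] leD by blast
  qed
qed

lemma join_of_S: "join_of (S a) = a"
  by (simp add: join_of_eqI S_subset_ell)

lemma inj_S: "inj S"
  by (metis join_of_S injI)

lemma range_S_iff:
  assumes md: "meet_distributive TYPE('a::{finite, semilattice_inf})"
  shows "A \<in> range (S :: 'a \<Rightarrow> _) \<longleftrightarrow>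
    (\<exists>a::'a. A \<subseteq> ell a) \<and> (\<forall>p\<in>A. p \<notin> ell (join_of (A - {p})))"
proof
  assume "A \<in> range (S :: 'a \<Rightarrow> _)"
  then obtain a where a: "A = S a" by blast
  have "p \<notin> ell (join_of (A - {p}))" if "p \<in> A" for p
  proof -
    obtain b where b: "ell b = ell a - {p}"
      using S_imp_lower_neighbor[OF md, of p a] \<open>p \<in> A\<close> a by metis
    then have "join_of (A - {p}) \<le> b"
      using a S_subset_ell[of a] by (intro join_of_le) auto
    with b show ?thesis unfolding ell_def by (metis (no_types, lifting) DiffE insertI1 mem_Collect_eq order_trans)
  qed
  then show "(\<exists>a::'a. A \<subseteq> ell a) \<and> (\<forall>p\<in>A. p \<notin> ell (join_of (A - {p})))"
    using a S_subset_ell by blast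
next
  assume A: "(\<exists>a::'a. A \<subseteq> ell a) \<and> (\<forall>p\<in>A. p \<notin> ell (join_of (A - {p})))"
  then obtain a where a: "A \<subseteq> ell a" by blast
  have "A \<subseteq> S (join_of A)"
  proof (rule ccontr)
    assume "\<not> A \<subseteq> S (join_of A)"
    then obtain p where p: "p \<in> A" "p \<notin> S (join_of A)" by blast
    then have "S (join_of A) \<subseteq> A - {p}" using S_subset_of_join_of[OF md a] by blast
    moreover have "A - {p} \<subseteq> ell (join_of A)" using subset_ell_join_of[OF a] by blast
    ultimately have "join_of (A - {p}) = join_of A" by (rule join_of_eqI)
    then show False using A p(1) subset_ell_join_of[OF a] by (metis subsetD)
  qed
  then show "A \<in> range (S :: 'a \<Rightarrow> _)" using S_subset_of_join_of[OF md a] by blast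
qed

lemma join_of_mono:
  assumes "A \<subseteq> B" "B \<subseteq> ell a"
  shows "join_of A \<le> join_of B"
  by (rule join_of_le) (use assms subset_ell_join_of in blast)

text \<open>Provides the vertices of the complex: \<open>p\<close> is the join of
  \<open>{p}\<close>, and its lower neighbor loses \<open>p\<close>.\<close>

lemma S_join_irreducible:
  assumes md: "meet_distributive TYPE('a::{finite, semilattice_inf})"
    and p: "p \<in> join_irreducibles"
  shows "S (p::'a) = {p}"
proof -
  obtain b where "lower_neighbors p = {b}" by (rule join_irreducible_below[OF p])
  then have N: "b \<in> lower_neighbors p" by simp
  have pp: "p \<in> ell p" using p unfolding ell_def by simp
  have pb: "\<not> p \<le> b" using lower_neighbors_less[OF N] by (auto dest: leD)
  have "p \<le> join_of {p}" using subset_ell_join_of[of "{p}" p] pp by (simp add: ell_def)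
  moreover have "join_of {p} \<le> p" using pp by (intro join_of_le) simp
  ultimately have "join_of {p} = p" by simp
  then have "S p \<subseteq> {p}" using S_subset_of_join_of[OF md, of "{p}" p] pp by auto
  moreover have "p \<in> S p" unfolding S_iff using pp N pb by blast
  ultimately show ?thesis by blast
qed

text \<open>In a smaller set the join of the other points is smaller, so the criterion for being
  some \<open>S a\<close> passes to subsets.\<close>

lemma simplicial_complex_range_S:
  assumes md: "meet_distributive TYPE('a::{finite, semilattice_inf})"
  shows "simplicial_complex_on (join_irreducibles :: 'a set) (range S)"
proof -
  have sub: "G \<in> range S" if F: "F \<in> range (S::'a \<Rightarrow> _)" and "G \<subseteq> F" for F G
  proof -
    obtain a where a: "F \<subseteq> ell a" and indep: "\<forall>p\<in>F. p \<notin> ell (join_of (F - {p}))"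
      using iffD1[OF range_S_iff[OF md] F] by blast
    have "p \<notin> ell (join_of (G - {p}))" if "p \<in> G" for p
      using join_of_mono[of "G - {p}" "F - {p}" a] a indep \<open>G \<subseteq> F\<close> that ell_mono by blast
    then show ?thesis unfolding range_S_iff[OF md] using a \<open>G \<subseteq> F\<close> by blast
  qed
  moreover have "{} \<in> range (S::'a \<Rightarrow> _)" using sub[of "S _" "{}"] by blast
  moreover have "{v} \<in> range (S::'a \<Rightarrow> _)" if "v \<in> join_irreducibles" for v
    using S_join_irreducible[OF md that] by (metis rangeI)
  moreover have "range (S::'a \<Rightarrow> _) \<subseteq> Pow join_irreducibles"
    using S_subset_ell ell_subset by blast
  ultimately show ?thesis unfolding simplicial_complex_on_def by simp
qed


section \<open>The h-vector of the Alexander dual\<close>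

text \<open>The binomial theorem in subset form: expand the product over \<open>A\<close>, with
  \<open>T\<close> recording the factors that contribute \<open>x\<close>.\<close>

lemma sum_Pow_power_card:
  fixes x y :: "'b::comm_ring_1"
  assumes "finite A"
  shows "(\<Sum>T\<in>Pow A. x ^ card T * y ^ (card A - card T)) = (x + y) ^ card A"
proof -
  have "(x + y) ^ card A = (\<Sum>T\<in>Pow A. (\<Prod>_\<in>T. x) * (\<Prod>_\<in>A - T. y))"
    using prod_add[OF assms, of "\<lambda>_. x" "\<lambda>_. y"] by simp
  also have "\<dots> = (\<Sum>T\<in>Pow A. x ^ card T * y ^ (card A - card T))"
    using assms by (intro sum.cong) (simp_all add: card_Diff_subset finite_subset)
  finally show ?thesis ..
qed

text \<open>The members of the interval are the unions of \<open>G\<close> with subsets of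
  \<open>H - G\<close>; the binomial sum over these is a power of
  \<open>x + (1 - x) = 1\<close>.\<close>

lemma sum_interval_power_card:
  fixes x :: "'b::comm_ring_1"
  assumes H: "finite H" and GH: "G \<subseteq> H"
  shows "(\<Sum>F | G \<subseteq> F \<and> F \<subseteq> H. x ^ card F * (1 - x) ^ (card H - card F)) = x ^ card G"
proof -
  let ?f = "\<lambda>F. x ^ card F * (1 - x) ^ (card H - card F)"
  have G: "finite G" using assms finite_subset by blast
  have card_H: "card H = card G + card (H - G)"
    using assms by (metis G card_Diff_subset card_mono le_add_diff_inverse)
  have "{F. G \<subseteq> F \<and> F \<subseteq> H} = (\<lambda>T. G \<union> T) ` Pow (H - G)"
  proof (intro subset_antisym subsetI)
    fix F assume "F \<in> {F. G \<subseteq> F \<and> F \<subseteq> H}"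
    then have "F = G \<union> (F - G)" "F - G \<in> Pow (H - G)" by auto
    then show "F \<in> (\<lambda>T. G \<union> T) ` Pow (H - G)" by blast
  qed (use GH in auto)
  moreover have "inj_on (\<lambda>T. G \<union> T) (Pow (H - G))" unfolding inj_on_def by blast
  ultimately have "sum ?f {F. G \<subseteq> F \<and> F \<subseteq> H} = (\<Sum>T\<in>Pow (H - G). ?f (G \<union> T))"
    by (simp add: sum.reindex)
  also have "\<dots> = (\<Sum>T\<in>Pow (H - G). x ^ card G * (x ^ card T * (1 - x) ^ (card (H - G) - card T)))"
  proof (rule sum.cong)
    fix T assume T: "T \<in> Pow (H - G)"
    then have "finite T" using H finite_subset by blast
    then have "card (G \<union> T) = card G + card T" using G T by (intro card_Un_disjoint) auto
    then show "?f (G \<union> T) = x ^ card G * (x ^ card T * (1 - x) ^ (card (H - G) - card T))"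
      using card_H by (simp add: power_add mult.assoc)
  qed simp
  also have "\<dots> = x ^ card G"
    using H by (simp add: sum_distrib_left[symmetric] sum_Pow_power_card)
  finally show ?thesis .
qed

text \<open>Turns a sum over face sizes into one over faces, which can then be regrouped into
  intervals.\<close>

lemma sum_f_number:
  fixes g :: "nat \<Rightarrow> 'b::comm_ring_1"
  assumes "finite \<Delta>" and "\<And>F. F \<in> \<Delta> \<Longrightarrow> card F \<le> d"
  shows "(\<Sum>j\<le>d. of_nat (f_number \<Delta> j) * g j) = (\<Sum>F\<in>\<Delta>. g (card F))"
proof -
  have "(\<Sum>F\<in>\<Delta>. g (card F)) = (\<Sum>j\<in>{..d}. \<Sum>F | F \<in> \<Delta> \<and> card F = j. g (card F))"
    by (rule sum.group[symmetric]) (use assms in auto)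
  also have "\<dots> = (\<Sum>j\<le>d. of_nat (f_number \<Delta> j) * g j)"
    unfolding f_number_def by (intro sum.cong) simp_all
  finally show ?thesis ..
qed

section \<open>Purity and dimension of the Alexander dual\<close>

lemma card_dual_facet: "card (dual_facet (a::'a::{finite, order})) = card (join_irreducibles :: 'a set)"
proof -
  have fin: "finite A" for A :: "'a set" by (rule finite_subset[OF subset_UNIV finite_UNIV])
  \<comment> \<open>Each join-irreducible \<open>p\<close> contributes exactly one of the vertices
    \<open>Inl p\<close> and \<open>Inr p\<close>.\<close>
  have "card (dual_facet a) = card (Inl ` (join_irreducibles - ell a) :: ('a + 'a) set) + card (Inr ` ell a :: ('a + 'a) set)"
    unfolding dual_facet_def using fin by (intro card_Un_disjoint) auto
  also have "\<dots> = card (join_irreducibles - ell a) + card (ell a)"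
    by (simp add: card_image)
  also have "\<dots> = card (join_irreducibles :: 'a set)"
    using ell_subset[of a] fin by (metis add.commute card_Diff_subset card_mono le_add_diff_inverse)
  finally show ?thesis .
qed

lemma dim_plus_one_alexander_dual:
  "dim_plus_one (alexander_dual :: ('a::{finite, order} + 'a) set set) = card (join_irreducibles :: 'a set)"
  unfolding dim_plus_one_def
proof (rule Max_eqI)
  show "finite (card ` (alexander_dual :: ('a + 'a) set set))" by simp
  \<comment> \<open>All facets have this size; \<open>undefined\<close> serves as an arbitrary
    element to name one.\<close>
  show "card (join_irreducibles :: 'a set) \<in> card ` (alexander_dual :: ('a + 'a) set set)"
    using card_dual_facet[of undefined] unfolding alexander_dual_def by (metis (mono_tags, lifting) image_eqI mem_Collect_eq order_refl)
  fix k assume "k \<in> card ` (alexander_dual :: ('a + 'a) set set)"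
  then obtain F and a :: 'a where "k = card F" "F \<subseteq> dual_facet a" unfolding alexander_dual_def by blast
  then show "k \<le> card (join_irreducibles :: 'a set)"
    using card_mono[of "dual_facet a" F] card_dual_facet[of a] by simp
qed

text \<open>Sorting the faces \<open>F\<close> by the join of their \<open>y\<close>-part partitions the dual into the intervals
  from \<open>Inr ` S a\<close> to \<open>dual_facet a\<close>.\<close>

lemma alexander_dual_interval:
  assumes md: "meet_distributive TYPE('a::{finite, semilattice_inf})"
  shows "{F \<in> alexander_dual. join_of (Inr -` F) = (a::'a)} = {F. Inr ` S a \<subseteq> F \<and> F \<subseteq> dual_facet a}"
proof (intro subset_antisym subsetI)
  fix F assume "F \<in> {F \<in> alexander_dual. join_of (Inr -` F) = a}"
  then obtain c where c: "F \<subseteq> dual_facet c" and a: "join_of (Inr -` F) = a"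
    unfolding alexander_dual_def by blast
  have Fc: "Inr -` F \<subseteq> ell c" using c unfolding dual_facet_def by blast
  have S: "S a \<subseteq> Inr -` F" "Inr -` F \<subseteq> ell a"
    using a S_subset_of_join_of[OF md Fc] subset_ell_join_of[OF Fc] by simp_all
  \<comment> \<open>The element \<open>c\<close> belongs to some facet containing \<open>F\<close>;
    as \<open>a\<close> is at most \<open>c\<close>, an x-vertex outside \<open>ell c\<close> is
    also outside \<open>ell a\<close>.\<close>
  have "ell a \<subseteq> ell c" using join_of_le[OF Fc] a ell_mono by blast
  have "F \<subseteq> dual_facet a"
  proof
    fix v assume v: "v \<in> F"
    then show "v \<in> dual_facet a"
    proof (cases v)
      case (Inl p)
      then have "p \<in> join_irreducibles - ell c" using v c unfolding dual_facet_def by blast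
      then show ?thesis using Inl \<open>ell a \<subseteq> ell c\<close> unfolding dual_facet_def by blast
    next
      case (Inr p)
      then show ?thesis using v S(2) unfolding dual_facet_def by blast
    qed
  qed
  with S(1) show "F \<in> {F. Inr ` S a \<subseteq> F \<and> F \<subseteq> dual_facet a}" by blast
next
  fix F assume "F \<in> {F. Inr ` S a \<subseteq> F \<and> F \<subseteq> dual_facet a}"
  then have F: "Inr ` S a \<subseteq> F" "F \<subseteq> dual_facet a" by simp_all
  then have "S a \<subseteq> Inr -` F" "Inr -` F \<subseteq> ell a" unfolding dual_facet_def by blast+
  then have "join_of (Inr -` F) = a" by (rule join_of_eqI)
  with F show "F \<in> {F \<in> alexander_dual. join_of (Inr -` F) = a}"
    unfolding alexander_dual_def by blast
qed

theorem h_number_alexander_dual: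
  assumes md: "meet_distributive TYPE('a::{finite, semilattice_inf})"
  shows "h_number (alexander_dual :: ('a + 'a) set set) i = int (f_number (range (S :: 'a \<Rightarrow> 'a set)) i)"
proof -
  let ?\<Delta> = "alexander_dual :: ('a + 'a) set set" and ?n = "card (join_irreducibles :: 'a set)"
  let ?g = "\<lambda>k. [:0, 1:] ^ k * [:1, -1:] ^ (?n - k) :: int poly"
  \<comment> \<open>Lets the interval identity be used with \<open>x\<close> taken as the polynomial
    variable \<open>[:0, 1:]\<close>.\<close>
  have minus: "[:1, -1:] = 1 - [:0, 1 :: int:]" by (simp add: one_pCons)
  have le: "card F \<le> ?n" if F: "F \<in> ?\<Delta>" for F
  proof -
    obtain a :: 'a where "F \<subseteq> dual_facet a" using F unfolding alexander_dual_def by blast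
    then show ?thesis using card_mono[of "dual_facet a" F] card_dual_facet[of a] by simp
  qed
  have sub: "Inr ` S a \<subseteq> dual_facet a" for a :: 'a
    using S_subset_ell unfolding dual_facet_def by blast
  have monom: "monom (int k) j = of_nat k * [:0, 1:] ^ j" for k j
    by (simp add: monom_altdef of_nat_poly)
  have "(\<Sum>j\<le>?n. monom (int (f_number ?\<Delta> j)) j * [:1, -1:] ^ (?n - j))
      = (\<Sum>j\<le>?n. of_nat (f_number ?\<Delta> j) * ?g j)"
    by (simp only: monom mult.assoc)
  also have "\<dots> = (\<Sum>F\<in>?\<Delta>. ?g (card F))"
    by (rule sum_f_number) (use le in simp_all)
  also have "\<dots> = (\<Sum>a\<in>(UNIV::'a set). \<Sum>F | F \<in> ?\<Delta> \<and> join_of (Inr -` F) = a. ?g (card F))"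
    by (rule sum.group[symmetric]) simp_all
  also have "\<dots> = (\<Sum>a\<in>(UNIV::'a set). [:0, 1:] ^ card (S a))"
  proof (rule sum.cong)
    fix a :: 'a
    have "(\<Sum>F | Inr ` S a \<subseteq> F \<and> F \<subseteq> dual_facet a. ?g (card F)) = [:0, 1:] ^ card (Inr ` S a :: ('a + 'a) set)"
      using sum_interval_power_card[OF finite sub[of a], of "[:0, 1::int:]"]
      unfolding minus card_dual_facet .
    then show "(\<Sum>F | F \<in> ?\<Delta> \<and> join_of (Inr -` F) = a. ?g (card F)) = [:0, 1:] ^ card (S a)"
      unfolding alexander_dual_interval[OF md] by (simp add: card_image)
  qed simp
  also have "\<dots> = (\<Sum>a\<in>(UNIV::'a set). monom 1 (card (S a)))"
    by (simp add: monom_altdef)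
  finally have "h_number ?\<Delta> i = (\<Sum>a\<in>(UNIV::'a set). if card (S a) = i then 1 else 0)"
    unfolding h_number_def dim_plus_one_alexander_dual by (simp add: coeff_sum)
  also have "\<dots> = int (card {a::'a. card (S a) = i})"
    by (simp add: sum.If_cases)
  \<comment> \<open>Since \<open>S\<close> is injective, counting elements of the semilattice is
    counting faces.\<close>
  also have "card {a::'a. card (S a) = i} = f_number (range (S :: 'a \<Rightarrow> 'a set)) i"
  proof -
    have "{F \<in> range S. card F = i} = S ` {a::'a. card (S a) = i}" by blast
    then show ?thesis unfolding f_number_def using inj_S by (metis card_image inj_on_subset subset_UNIV)
  qed
  finally show ?thesis .
qed


section \<open>Monomials outside the ideal\<close>

definition exponents :: "'v::finite set \<Rightarrow> ('v \<Rightarrow>\<^sub>0 nat)"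
  where "exponents A = (\<Sum>p\<in>A. Poly_Mapping.single p 1)"

lemma lookup_exponents: "Poly_Mapping.lookup (exponents A) p = (if p \<in> A then 1 else 0)"
  by (simp add: exponents_def lookup_sum lookup_single when_def)

lemma keys_exponents: "Poly_Mapping.keys (exponents A) = A"
  by (auto simp: in_keys_iff lookup_exponents split: if_splits)

lemma inj_exponents: "inj exponents"
  by (metis injI keys_exponents)

lemma prod_var: "(\<Prod>p\<in>A. var p) = (Poly_Mapping.single (exponents A) 1 :: ('v::finite, 'k::field) mpoly)"
proof -
  have "finite A" by simp
  then show ?thesis
    by (induction A) (simp_all add: exponents_def var_def mult_single)
qed

lemma u_eq_single: "u a = Poly_Mapping.single (exponents (S a)) 1"
  by (simp add: u_def prod_var)

text \<open>The three sets follow \<open>gens_order\<close>, \<open>gens_unbounded\<close> and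
  \<open>gens_closure\<close>. Working with exponents turns divisibility of monomials into addition
  of vectors.\<close>

definition generator_exponents :: "('a::{finite, semilattice_inf} \<Rightarrow>\<^sub>0 nat) set"
  where "generator_exponents =
    {Poly_Mapping.single p 1 + Poly_Mapping.single q 1 | p q.
       p \<in> join_irreducibles \<and> q \<in> join_irreducibles \<and> p \<le> q} \<union>
    {exponents B | B. B \<subseteq> join_irreducibles \<and> antichain B \<and> \<not> (\<exists>a. poset_ideal B \<subseteq> ell a)} \<union>
    {Poly_Mapping.single p 1 + exponents B | p B. B \<subseteq> join_irreducibles \<and> antichain B \<and>
       \<not> (\<exists>b. ell b = poset_ideal B) \<and> (\<exists>a. poset_ideal B \<subseteq> ell a) \<and>
       p \<in> ell (\<Sqinter>\<^sub>f\<^sub>i\<^sub>n {a. poset_ideal B \<subseteq> ell a}) - poset_ideal B}"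

lemma generators_eq:
  "gens_order \<union> gens_unbounded \<union> gens_closure =
    (\<lambda>m. Poly_Mapping.single m 1 :: ('a::{finite, semilattice_inf}, 'k::field) mpoly) ` generator_exponents"
  unfolding gens_order_def gens_unbounded_def gens_closure_def generator_exponents_def
    image_Un image_Collect prod_var
  unfolding var_def mult_single
  by (intro arg_cong2[where f = "(\<union>)"]) (simp_all, blast+)

text \<open>\<open>ell a\<close> is a down-set of join-irreducibles. The conditions on
  \<open>B\<close> in the generators thereby become statements about bounds of \<open>B\<close> and
  \<open>join_of B\<close>.\<close>

lemma poset_ideal_subset_ell:
  assumes "B \<subseteq> join_irreducibles"
  shows "poset_ideal B \<subseteq> ell a \<longleftrightarrow> B \<subseteq> ell a"
proof
  assume "poset_ideal B \<subseteq> ell a"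
  then show "B \<subseteq> ell a" using assms unfolding poset_ideal_def by blast
next
  assume "B \<subseteq> ell a"
  then show "poset_ideal B \<subseteq> ell a" unfolding poset_ideal_def ell_def
    by (smt (verit) mem_Collect_eq order_trans subset_iff)
qed

text \<open>\<open>u a\<close> is squarefree with bounded support in which no point lies below the
  join of the others; each type of generator would violate one of these properties.\<close>

lemma generator_not_dvd_standard:
  fixes m k :: "'a::{finite, semilattice_inf} \<Rightarrow>\<^sub>0 nat"
  assumes md: "meet_distributive TYPE('a)"
    and m: "m \<in> generator_exponents"
  shows "m + k \<noteq> exponents (S a)"
proof
  assume eq: "m + k = exponents (S a)"
  have le: "Poly_Mapping.lookup m p \<le> (if p \<in> S a then 1 else 0)" for p
    using arg_cong[OF eq, of "\<lambda>f. Poly_Mapping.lookup f p"]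
    unfolding lookup_add lookup_exponents by linarith
  have mem: "p \<in> S a" if "Poly_Mapping.lookup m p > 0" for p
    using le[of p] that by (simp split: if_splits)
  have indep: "p \<notin> ell (join_of (S a - {p}))" if p: "p \<in> S a" for p
    using iffD1[OF range_S_iff[OF md, of "S a"]] p by blast
  have bdd: "S a - {p} \<subseteq> ell a" for p using S_subset_ell by blast
  from m show False
    unfolding generator_exponents_def
  proof (elim UnE CollectE exE conjE)
    fix p q
    assume m_eq: "m = Poly_Mapping.single p 1 + Poly_Mapping.single q 1"
      and p: "p \<in> join_irreducibles" and "p \<le> q"
    have pq: "p \<in> S a" "q \<in> S a" using mem[of p] mem[of q] unfolding m_eq lookup_add by simp_all
    \<comment> \<open>For \<open>p = q\<close> the generator is a square, with exponent 2 at
      \<open>p\<close>.\<close>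
    have "p \<noteq> q" using le[of p] unfolding m_eq lookup_add by (auto split: if_splits)
    then have "q \<in> ell (join_of (S a - {p}))" using pq subset_ell_join_of[OF bdd[of p]] by blast
    then have "p \<in> ell (join_of (S a - {p}))"
      using p \<open>p \<le> q\<close> unfolding ell_def by (auto intro: order_trans)
    then show False using indep pq by blast
  next
    fix B
    assume m_eq: "m = exponents B" and B: "B \<subseteq> join_irreducibles"
      and unbounded: "\<not> (\<exists>a. poset_ideal B \<subseteq> ell a)"
    have "B \<subseteq> S a" using mem unfolding m_eq lookup_exponents by auto
    then show False using S_subset_ell[of a] unbounded poset_ideal_subset_ell[OF B] by blast
  next
    fix p B
    assume m_eq: "m = Poly_Mapping.single p 1 + exponents B" and B: "B \<subseteq> join_irreducibles"
      and p: "p \<in> ell (\<Sqinter>\<^sub>f\<^sub>i\<^sub>n {a. poset_ideal B \<subseteq> ell a}) - poset_ideal B"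
    have "p \<in> S a" using mem[of p] unfolding m_eq lookup_add by simp
    have "B \<subseteq> S a" using mem unfolding m_eq lookup_add lookup_exponents by auto
    \<comment> \<open>Since \<open>B\<close> avoids \<open>p\<close>, it lies in
      \<open>S a - {p}\<close>, so \<open>p\<close> falls below the join of the other
      points.\<close>
    moreover have "p \<notin> B" using B p unfolding poset_ideal_def by auto
    ultimately have "join_of B \<le> join_of (S a - {p})" by (intro join_of_mono[OF _ bdd]) blast
    moreover have "p \<in> ell (join_of B)"
      using p unfolding join_of_def poset_ideal_subset_ell[OF B] by blast
    ultimately have "p \<in> ell (join_of (S a - {p}))"
      using ell_mono by blast
    then show False using indep \<open>p \<in> S a\<close> by blast
  qed
qed

text \<open>Subtraction of exponents is truncated at zero, so this equation expresses that
  \<open>g\<close> divides \<open>m\<close>.\<close>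

lemma exponents_diff:
  fixes g m :: "'v \<Rightarrow>\<^sub>0 nat"
  assumes "\<And>p. Poly_Mapping.lookup g p \<le> Poly_Mapping.lookup m p"
  shows "g + (m - g) = m"
  by (rule poly_mapping_eqI) (simp add: lookup_add lookup_minus assms)

text \<open>If no generator divides \<open>m\<close>, the order generators make it squarefree with
  antichain support \<open>A\<close>, and the unbounded ones make \<open>A\<close> bounded. As
  \<open>A\<close> is no \<open>S a\<close>, some \<open>p\<close> in \<open>A\<close> lies below
  the join of \<open>A - {p}\<close>, which gives a generator of the third type.\<close>

lemma nonstandard_imp_generator_dvd:
  fixes m :: "'a::{finite, semilattice_inf} \<Rightarrow>\<^sub>0 nat"
  assumes md: "meet_distributive TYPE('a)"
    and keys: "Poly_Mapping.keys m \<subseteq> join_irreducibles"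
    and nonstd: "m \<notin> range (\<lambda>a. exponents (S a))"
  obtains g where "g \<in> generator_exponents" "g + (m - g) = m"
proof (rule ccontr)
  assume contra: "\<not> thesis"
  note dvd = that
  have nodvd: "\<exists>p. \<not> Poly_Mapping.lookup g p \<le> Poly_Mapping.lookup m p"
    if g: "g \<in> generator_exponents" for g
    using contra dvd[OF g] exponents_diff[of g m] by blast
  define A where "A = Poly_Mapping.keys m"
  have A: "A \<subseteq> join_irreducibles" using keys unfolding A_def .
  have pos: "Poly_Mapping.lookup m p > 0 \<longleftrightarrow> p \<in> A" for p unfolding A_def by (simp add: in_keys_iff)
  have order: "Poly_Mapping.single p 1 + Poly_Mapping.single q 1 \<in> generator_exponents"
    if "p \<in> A" "q \<in> A" "p \<le> q" for p q
    unfolding generator_exponents_def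
    by (rule UnI1, rule UnI1, rule CollectI, rule exI[of _ p], rule exI[of _ q])
      (use that A in blast)
  \<comment> \<open>The order generators include squares, as \<open>p \<le> p\<close>.\<close>
  have sq: "Poly_Mapping.lookup m p \<le> 1" for p
  proof (cases "p \<in> A")
    case True
    then obtain r where "\<not> Poly_Mapping.lookup (Poly_Mapping.single p 1 + Poly_Mapping.single p 1) r \<le> Poly_Mapping.lookup m r"
      using nodvd[OF order[of p p]] by blast
    then show ?thesis by (cases "r = p") (simp_all add: lookup_add lookup_single when_def)
  qed (use pos[of p] in simp)
  have m: "m = exponents A"
  proof (rule poly_mapping_eqI)
    fix p show "Poly_Mapping.lookup m p = Poly_Mapping.lookup (exponents A) p"
      using sq[of p] pos[of p] by (auto simp: lookup_exponents)
  qed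
  have anti: "antichain A"
    unfolding antichain_def
  proof (intro ballI impI)
    fix p q assume pq: "p \<in> A" "q \<in> A" "p \<le> q"
    obtain r where "\<not> Poly_Mapping.lookup (Poly_Mapping.single p 1 + Poly_Mapping.single q 1) r \<le> Poly_Mapping.lookup m r"
      using nodvd[OF order[OF pq]] by blast
    then show "p = q"
      using pq unfolding m by (auto simp: lookup_add lookup_single lookup_exponents when_def split: if_splits)
  qed
  have "\<exists>a. poset_ideal A \<subseteq> ell a"
  proof (rule ccontr)
    assume unbounded: "\<not> (\<exists>a. poset_ideal A \<subseteq> ell a)"
    have "m \<in> generator_exponents"
      unfolding generator_exponents_def m
      by (rule UnI1, rule UnI2, rule CollectI, rule exI[of _ A]) (use A anti unbounded in blast)
    then show False using nodvd by blast
  qed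
  then obtain c where c: "A \<subseteq> ell c" using poset_ideal_subset_ell[OF A] by blast
  moreover have "A \<notin> range S" using nonstd m by auto
  ultimately obtain p where p: "p \<in> A" "p \<in> ell (join_of (A - {p}))"
    using range_S_iff[OF md, of A] by blast
  let ?B = "A - {p}"
  have B: "?B \<subseteq> join_irreducibles" using A by blast
  have pB: "p \<notin> poset_ideal ?B"
    using anti p(1) unfolding poset_ideal_def antichain_def by auto
  \<comment> \<open>If the ideal generated by \<open>?B\<close> were some \<open>ell b\<close>, it
    would contain \<open>p\<close>, which lies below the join of \<open>?B\<close>; the antichain
    property forbids this.\<close>
  have unclosed: "ell b \<noteq> poset_ideal ?B" for b
  proof
    assume b: "ell b = poset_ideal ?B"
    then have "?B \<subseteq> ell b" using poset_ideal_subset_ell[OF B] by blast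
    then have "p \<in> ell b" using p(2) join_of_le ell_mono by blast
    then show False using b pB by simp
  qed
  have bounded: "\<exists>a. poset_ideal ?B \<subseteq> ell a" using c poset_ideal_subset_ell[OF B] by blast
  have antichain: "antichain ?B" using anti unfolding antichain_def by blast
  have in_closure: "p \<in> ell (\<Sqinter>\<^sub>f\<^sub>i\<^sub>n {a. poset_ideal ?B \<subseteq> ell a})"
    using p(2) unfolding join_of_def poset_ideal_subset_ell[OF B] .
  have "Poly_Mapping.single p 1 + exponents ?B \<in> generator_exponents"
    unfolding generator_exponents_def
    by (rule UnI2, rule CollectI, rule exI[of _ p], rule exI[of _ ?B])
      (use B pB unclosed bounded antichain in_closure in blast)
  \<comment> \<open>The generator obtained is \<open>m\<close> itself.\<close>
  moreover have "Poly_Mapping.single p 1 + exponents ?B = m"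
    unfolding m using p(1) by (intro poly_mapping_eqI) (auto simp: lookup_add lookup_single lookup_exponents when_def)
  ultimately show False using nodvd by blast
qed


section \<open>The quotient ring\<close>

lemma poly_ring_simps:
  "f \<oplus>\<^bsub>poly_ring V\<^esub> g = f + g" "f \<otimes>\<^bsub>poly_ring V\<^esub> g = f * g" "\<zero>\<^bsub>poly_ring V\<^esub> = 0" "\<one>\<^bsub>poly_ring V\<^esub> = 1"
  by (simp_all add: poly_ring_def)

lemma poly_ring_carrier:
  "f \<in> carrier (poly_ring V) \<longleftrightarrow> (\<forall>m\<in>Poly_Mapping.keys f. Poly_Mapping.keys m \<subseteq> V)"
  by (simp add: poly_ring_def)

lemma single_in_poly_ring: "Poly_Mapping.keys m \<subseteq> V \<Longrightarrow> Poly_Mapping.single m c \<in> carrier (poly_ring V)"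
  by (simp add: poly_ring_carrier)

lemma const_in_poly_ring: "const c \<in> carrier (poly_ring V)"
  by (simp add: const_def single_in_poly_ring)

lemma u_in_poly_ring: "u a \<in> carrier (poly_ring join_irreducibles)"
  using S_subset_ell ell_subset by (force simp: u_eq_single keys_exponents intro!: single_in_poly_ring)

lemma poly_ring_uminus:
  fixes f :: "('v, 'k::field) mpoly"
  assumes "f \<in> carrier (poly_ring V)"
  shows "\<ominus>\<^bsub>poly_ring V\<^esub> f = - f"
proof -
  interpret cring "poly_ring V :: ('v, 'k) mpoly ring" by (rule poly_ring_cring)
  have "- f \<in> carrier (poly_ring V)" using assms by (simp add: poly_ring_carrier)
  with assms show ?thesis by (intro minus_equality) (simp_all add: poly_ring_simps)
qed

section \<open>The ideal described through coefficients\<close>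

definition standard_vanishing :: "('a::{finite, semilattice_inf}, 'k::field) mpoly set"
  where "standard_vanishing = {f \<in> carrier (poly_ring join_irreducibles).
    \<forall>a. Poly_Mapping.lookup f (exponents (S a)) = 0}"

lemma sum_single_lookup: "(\<Sum>m\<in>Poly_Mapping.keys f. Poly_Mapping.single m (Poly_Mapping.lookup f m)) = f"
  by (rule poly_mapping_eqI)
    (auto simp: lookup_sum lookup_single when_def in_keys_iff)

lemma generator_keys:
  assumes "g \<in> generator_exponents" shows "Poly_Mapping.keys g \<subseteq> join_irreducibles"
  using assms unfolding generator_exponents_def
proof (elim UnE CollectE exE conjE)
  fix p q assume "g = Poly_Mapping.single p 1 + Poly_Mapping.single q 1"
    "p \<in> join_irreducibles" "q \<in> join_irreducibles"
  then show ?thesis using keys_add[of "Poly_Mapping.single p (1::nat)" "Poly_Mapping.single q 1"] by auto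
next
  fix B assume "g = exponents B" "B \<subseteq> join_irreducibles"
  then show ?thesis by (simp add: keys_exponents)
next
  fix p B assume g: "g = Poly_Mapping.single p 1 + exponents B" and B: "B \<subseteq> join_irreducibles"
    and p: "p \<in> ell (\<Sqinter>\<^sub>f\<^sub>i\<^sub>n {a. poset_ideal B \<subseteq> ell a}) - poset_ideal B"
  have "p \<in> join_irreducibles" using p ell_subset by blast
  then show ?thesis using B keys_add[of "Poly_Mapping.single p (1::nat)" "exponents B"]
    unfolding g by (auto simp: keys_exponents)
qed

text \<open>Only products need an argument: a standard term of \<open>f * g\<close>, one at some
  \<open>exponents (S a)\<close>, would be a multiple of a nonstandard term of \<open>f\<close>,
  hence of a generator, but generators divide no standard monomial.\<close>

lemma ideal_standard_vanishing:
  assumes md: "meet_distributive TYPE('a::{finite, semilattice_inf})"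
  shows "ideal (standard_vanishing :: ('a, 'k::field) mpoly set) (poly_ring join_irreducibles)"
proof (rule idealI)
  let ?R = "poly_ring join_irreducibles :: ('a, 'k) mpoly ring"
  interpret cring ?R by (rule poly_ring_cring)
  show "ring ?R" by (rule ring_axioms)
  show "subgroup standard_vanishing (add_monoid ?R)"
  proof (rule add.subgroupI)
    show "standard_vanishing \<subseteq> carrier ?R" unfolding standard_vanishing_def by blast
    have "0 \<in> (standard_vanishing :: ('a, 'k) mpoly set)"
      unfolding standard_vanishing_def by (simp add: poly_ring_carrier)
    then show "(standard_vanishing :: ('a, 'k) mpoly set) \<noteq> {}" by blast
    show "\<ominus>\<^bsub>?R\<^esub> f \<in> standard_vanishing" if "f \<in> standard_vanishing" for f
      using that by (simp add: standard_vanishing_def poly_ring_uminus) (simp add: poly_ring_carrier)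
    show "f \<oplus>\<^bsub>?R\<^esub> g \<in> standard_vanishing" if "f \<in> standard_vanishing" "g \<in> standard_vanishing" for f g
      using that add.m_closed[of f g] by (simp add: standard_vanishing_def poly_ring_simps lookup_add)
  qed
  have mult: "f * g \<in> standard_vanishing"
    if f: "f \<in> standard_vanishing" and g: "g \<in> carrier ?R" for f g
  proof -
    have fR: "f \<in> carrier ?R" using f unfolding standard_vanishing_def by blast
    have "Poly_Mapping.lookup (f * g) (exponents (S a)) = 0" for a
    proof (rule ccontr)
      assume "Poly_Mapping.lookup (f * g) (exponents (S a)) \<noteq> 0"
      then have "exponents (S a) \<in> Poly_Mapping.keys (f * g)" by (simp add: in_keys_iff)
      then obtain m k where m: "m \<in> Poly_Mapping.keys f" and eq: "exponents (S a) = m + k"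
        using keys_mult[of f g] by blast
      have "m \<notin> range (\<lambda>a. exponents (S a))"
        using f m unfolding standard_vanishing_def by (auto simp: in_keys_iff)
      moreover have "Poly_Mapping.keys m \<subseteq> join_irreducibles" using fR m unfolding poly_ring_carrier by blast
      ultimately obtain e where e: "e \<in> generator_exponents" "e + (m - e) = m"
        using nonstandard_imp_generator_dvd[OF md] by metis
      have "e + ((m - e) + k) = exponents (S a)" unfolding eq using e(2) by (metis add.assoc)
      then show False using generator_not_dvd_standard[OF md e(1)] by blast
    qed
    then show ?thesis
      using m_closed[OF fR g] by (simp add: standard_vanishing_def poly_ring_simps)
  qed
  then show "f \<otimes>\<^bsub>?R\<^esub> g \<in> standard_vanishing" if "f \<in> standard_vanishing" "g \<in> carrier ?R" for f g
    using that by (simp add: poly_ring_simps)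
  show "g \<otimes>\<^bsub>?R\<^esub> f \<in> standard_vanishing" if "f \<in> standard_vanishing" "g \<in> carrier ?R" for f g
    using mult[OF that] by (simp add: poly_ring_simps mult.commute)
qed

text \<open>The generators have no standard term, which bounds the ideal from above. Conversely,
  every term of a polynomial in \<open>standard_vanishing\<close> is a multiple of a
  generator.\<close>

lemma J_ideal_eq:
  assumes md: "meet_distributive TYPE('a::{finite, semilattice_inf})"
  shows "(J_ideal :: ('a, 'k::field) mpoly set) = standard_vanishing"
proof
  let ?R = "poly_ring join_irreducibles :: ('a, 'k) mpoly ring"
  let ?G = "(\<lambda>m. Poly_Mapping.single m 1) ` generator_exponents :: ('a, 'k) mpoly set"
  interpret R: cring ?R by (rule poly_ring_cring)
  have J: "J_ideal = Idl\<^bsub>?R\<^esub> ?G" unfolding J_ideal_def generators_eq ..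
  have G: "?G \<subseteq> carrier ?R" using generator_keys by (auto intro!: single_in_poly_ring)
  \<comment> \<open>The cofactor \<open>0\<close> yields that a generator is not itself a standard
    monomial.\<close>
  have "?G \<subseteq> standard_vanishing"
    using G generator_not_dvd_standard[OF md, of _ 0]
    unfolding standard_vanishing_def by (auto simp: lookup_single when_def)
  then show "J_ideal \<subseteq> (standard_vanishing :: ('a, 'k) mpoly set)"
    unfolding J by (rule R.genideal_minimal[OF ideal_standard_vanishing[OF md]])
  interpret J: ideal J_ideal ?R unfolding J by (rule R.genideal_ideal[OF G])
  show "(standard_vanishing :: ('a, 'k) mpoly set) \<subseteq> J_ideal"
  proof
    fix f :: "('a, 'k) mpoly" assume f: "f \<in> standard_vanishing"
    have monomial: "Poly_Mapping.single m c \<in> J_ideal" if m: "m \<in> Poly_Mapping.keys f" for m and c :: 'k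
    proof -
      have keys: "Poly_Mapping.keys m \<subseteq> join_irreducibles"
        using f m unfolding standard_vanishing_def poly_ring_carrier by blast
      have "m \<notin> range (\<lambda>a. exponents (S a))"
        using f m unfolding standard_vanishing_def by (auto simp: in_keys_iff)
      then obtain e where e: "e \<in> generator_exponents" "e + (m - e) = m"
        using nonstandard_imp_generator_dvd[OF md keys] by metis
      have "Poly_Mapping.keys (m - e) \<subseteq> Poly_Mapping.keys m"
        by (auto simp: in_keys_iff lookup_minus)
      then have "Poly_Mapping.single (m - e) c \<in> carrier ?R"
        using keys by (intro single_in_poly_ring) blast
      moreover have "Poly_Mapping.single e 1 \<in> (J_ideal :: ('a, 'k) mpoly set)"
        unfolding J using R.genideal_self[OF G] e(1) by blast
      ultimately have "Poly_Mapping.single e 1 \<otimes>\<^bsub>?R\<^esub> Poly_Mapping.single (m - e) c \<in> J_ideal"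
        by (rule J.I_r_closed[rotated])
      then show ?thesis by (simp add: poly_ring_simps mult_single e(2))
    qed
    have "(\<Sum>m\<in>M. Poly_Mapping.single m (Poly_Mapping.lookup f m)) \<in> J_ideal"
      if "finite M" "M \<subseteq> Poly_Mapping.keys f" for M
      using that
    proof (induction M)
      case empty
      then show ?case using J.zero_closed by (simp add: poly_ring_simps)
    next
      case (insert m M)
      then show ?case
        using J.a_closed[of "Poly_Mapping.single m (Poly_Mapping.lookup f m)"] monomial[of m]
        by (simp add: poly_ring_simps)
    qed
    from this[OF finite_keys subset_refl] show "f \<in> J_ideal" by (simp add: sum_single_lookup)
  qed
qed

section \<open>Coordinates on the quotient ring\<close>

lemma ideal_J_ideal:
  assumes "meet_distributive TYPE('a::{finite, semilattice_inf})"
  shows "ideal (J_ideal :: ('a, 'k::field) mpoly set) (poly_ring join_irreducibles)"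
  unfolding J_ideal_eq[OF assms] by (rule ideal_standard_vanishing[OF assms])

text \<open>The difference lies in the ideal iff its standard coefficients vanish. These
  coefficients thus serve as coordinates on the quotient.\<close>

lemma residue_class_eq_iff:
  fixes f g :: "('a::{finite, semilattice_inf}, 'k::field) mpoly"
  assumes md: "meet_distributive TYPE('a)"
    and f: "f \<in> carrier (poly_ring join_irreducibles)" and g: "g \<in> carrier (poly_ring join_irreducibles)"
  shows "residue_class f = residue_class g \<longleftrightarrow>
    (\<forall>a. Poly_Mapping.lookup f (exponents (S a)) = Poly_Mapping.lookup g (exponents (S a)))"
proof -
  let ?R = "poly_ring join_irreducibles :: ('a, 'k) mpoly ring"
  interpret R: cring ?R by (rule poly_ring_cring)
  interpret J: ideal J_ideal ?R by (rule ideal_J_ideal[OF md])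
  have minus: "f \<ominus>\<^bsub>?R\<^esub> g = f - g"
    using g by (simp add: a_minus_def poly_ring_uminus poly_ring_simps)
  have "residue_class f = residue_class g \<longleftrightarrow> f \<ominus>\<^bsub>?R\<^esub> g \<in> J_ideal"
    unfolding residue_class_def
    using R.quotient_eq_iff_same_a_r_cos[OF J.ideal_axioms f g] by blast
  also have "\<dots> \<longleftrightarrow> (\<forall>a. Poly_Mapping.lookup (f - g) (exponents (S a)) = 0)"
    using R.minus_closed[OF f g] unfolding J_ideal_eq[OF md] standard_vanishing_def minus by blast
  finally show ?thesis by (simp add: lookup_minus)
qed

lemma inj_residue_class_u:
  assumes md: "meet_distributive TYPE('a::{finite, semilattice_inf})"
  shows "inj (\<lambda>a::'a. residue_class (u a :: ('a, 'k::field) mpoly))"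
proof (rule injI)
  fix a b :: 'a
  assume "residue_class (u a :: ('a, 'k) mpoly) = residue_class (u b)"
  then have "Poly_Mapping.lookup (u a :: ('a, 'k) mpoly) (exponents (S a))
      = Poly_Mapping.lookup (u b) (exponents (S a))"
    unfolding residue_class_eq_iff[OF md u_in_poly_ring u_in_poly_ring] by blast
  \<comment> \<open>The left-hand coefficient is 1, so the right-hand one is not 0.\<close>
  then have "exponents (S b) = exponents (S a)"
    by (simp add: u_eq_single lookup_single when_def split: if_splits)
  then show "a = b" using inj_exponents inj_S by (metis injD)
qed

section \<open>Constants as scalars, and the basis\<close>

lemma ring_hom_residue_class:
  assumes md: "meet_distributive TYPE('a::{finite, semilattice_inf})"
  shows "ring_hom_ring (poly_ring join_irreducibles) (quotient_ring :: ('a, 'k::field) mpoly set ring) residue_class"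
  using ideal.rcos_ring_hom_ring[OF ideal_J_ideal[OF md]]
  unfolding quotient_ring_def residue_class_def[abs_def] .

lemma carrier_quotient_ring:
  "carrier quotient_ring = residue_class ` carrier (poly_ring join_irreducibles)"
  unfolding quotient_ring_def residue_class_def FactRing_def A_RCOSETS_def' by auto

lemma const_ops:
  fixes c d :: "'k::comm_ring_1"
  shows "const (- c) = (- const c :: ('v, 'k) mpoly)"
    and "const c * const d = (const (c * d) :: ('v, 'k) mpoly)"
    and "const c + const d = (const (c + d) :: ('v, 'k) mpoly)"
    and "const 1 = (1 :: ('v, 'k) mpoly)" and "const 0 = (0 :: ('v, 'k) mpoly)"
  by (simp_all add: const_def single_uminus mult_single single_add)

text \<open>Makes \<open>scalars\<close> a subfield of the quotient, being the image of the
  constants under a ring homomorphism.\<close>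

lemma subfield_range_const:
  "subfield (range const :: ('v, 'k::field) mpoly set) (poly_ring V)"
proof -
  let ?R = "poly_ring V :: ('v, 'k) mpoly ring"
  interpret cring ?R by (rule poly_ring_cring)
  have "subring (range const) ?R"
  proof (rule subringI)
    show "range const \<subseteq> carrier ?R" using const_in_poly_ring by blast
    show "\<one>\<^bsub>?R\<^esub> \<in> range const" using const_ops(4) by (metis poly_ring_simps(4) rangeI)
    show "\<ominus>\<^bsub>?R\<^esub> f \<in> range const" if f: "f \<in> range const" for f
    proof -
      obtain c where "f = const c" using f by blast
      then show ?thesis using poly_ring_uminus[OF const_in_poly_ring, of V c] const_ops(1)[of c]
        by (metis rangeI)
    qed
    show "f \<otimes>\<^bsub>?R\<^esub> g \<in> range const" "f \<oplus>\<^bsub>?R\<^esub> g \<in> range const"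
      if "f \<in> range const" "g \<in> range const" for f g
      using that by (auto simp: poly_ring_simps const_ops)
  qed
  then have "subcring (range const) ?R" by (rule subcringI')
  then show ?thesis
  proof (rule subfieldI)
    have unit: "const c \<in> Units (?R\<lparr>carrier := range const\<rparr>)" if "c \<noteq> 0" for c
    proof -
      have "const (inverse c) * const c = (1 :: ('v, 'k) mpoly)"
        using that by (simp add: const_ops)
      then show ?thesis unfolding Units_def by (auto simp: poly_ring_simps mult.commute)
    qed
    have nonunit: "0 \<notin> Units (?R\<lparr>carrier := range const\<rparr>)"
      unfolding Units_def by (simp add: poly_ring_simps)
    show "Units (?R\<lparr>carrier := range const\<rparr>) = range const - {\<zero>\<^bsub>?R\<^esub>}"
    proof (intro subset_antisym subsetI)
      fix f assume f: "f \<in> Units (?R\<lparr>carrier := range const\<rparr>)"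
      then have "f \<in> range const" unfolding Units_def by simp
      with f nonunit show "f \<in> range const - {\<zero>\<^bsub>?R\<^esub>}" by (auto simp: poly_ring_simps)
    next
      fix f assume f: "f \<in> range const - {\<zero>\<^bsub>?R\<^esub>}"
      then obtain c where c: "f = const c" by blast
      with f have "c \<noteq> 0" by (auto simp: poly_ring_simps const_ops)
      then show "f \<in> Units (?R\<lparr>carrier := range const\<rparr>)" unfolding c by (rule unit)
    qed
  qed
qed

text \<open>The coordinates of a linear combination are its coefficients. \<open>combine\<close>
  stops at the end of the shorter list, so \<open>i\<close> is bounded by both lengths.\<close>

lemma lookup_combine_u:
  fixes cs :: "'k::field list" and xs :: "'a::{finite, semilattice_inf} list"
  defines "comb \<equiv> \<lambda>cs xs. ring.combine (poly_ring join_irreducibles :: ('a, 'k) mpoly ring) (map const cs) (map u xs)"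
  assumes "distinct xs"
  shows "a \<notin> set xs \<Longrightarrow> Poly_Mapping.lookup (comb cs xs) (exponents (S a)) = 0"
    and "i < length xs \<Longrightarrow> i < length cs \<Longrightarrow> Poly_Mapping.lookup (comb cs xs) (exponents (S (xs ! i))) = cs ! i"
proof -
  interpret cring "poly_ring join_irreducibles :: ('a, 'k) mpoly ring" by (rule poly_ring_cring)
  have comb_Nil: "comb cs [] = 0" "comb [] xs = 0" for cs xs
    unfolding comb_def by (cases cs; simp add: poly_ring_simps)+
  \<comment> \<open>The monomial \<open>u x\<close> has a single nonzero coordinate, the one at
    \<open>x\<close>.\<close>
  have comb_Cons: "Poly_Mapping.lookup (comb (c # cs) (x # xs)) (exponents (S a))
      = (if x = a then c else 0) + Poly_Mapping.lookup (comb cs xs) (exponents (S a))" for c cs x xs a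
  proof -
    have "exponents (S x) = exponents (S a) \<longleftrightarrow> x = a"
      using inj_exponents inj_S by (metis injD)
    then show ?thesis
      unfolding comb_def
      by (simp add: poly_ring_simps u_eq_single const_def mult_single lookup_add lookup_single when_def)
  qed
  show outside: "Poly_Mapping.lookup (comb cs xs) (exponents (S a)) = 0" if "a \<notin> set xs" for cs xs a
    using that
  proof (induction xs arbitrary: cs)
    case (Cons x xs)
    then show ?case by (cases cs) (auto simp: comb_Nil comb_Cons)
  qed (simp add: comb_Nil)
  show "Poly_Mapping.lookup (comb cs xs) (exponents (S (xs ! i))) = cs ! i"
    if "i < length xs" "i < length cs"
    using \<open>distinct xs\<close> that
  proof (induction xs arbitrary: cs i)
    case (Cons x xs)
    then obtain c cs' where cs: "cs = c # cs'" by (cases cs) auto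
    show ?case
    proof (cases i)
      case 0
      then show ?thesis using Cons.prems by (simp add: cs comb_Cons outside)
    next
      case (Suc j)
      then have "x \<noteq> xs ! j" using Cons.prems by auto
      then show ?thesis using Suc Cons.prems Cons.IH[of j cs'] by (simp add: cs comb_Cons)
    qed
  qed simp
qed

text \<open>Combinations in the quotient lift to combinations of monomials with constant
  coefficients; comparing coordinates then gives independence and spanning.\<close>

theorem is_finite_basis_residue_class_u:
  assumes md: "meet_distributive TYPE('a::{finite, semilattice_inf})"
  shows "is_finite_basis (quotient_ring :: ('a, 'k::field) mpoly set ring) scalars
    ((\<lambda>a. residue_class (u a)) ` UNIV)"
proof -
  let ?R = "poly_ring join_irreducibles :: ('a, 'k) mpoly ring"
  let ?Q = "quotient_ring :: ('a, 'k) mpoly set ring"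
  interpret h: ring_hom_ring ?R ?Q residue_class by (rule ring_hom_residue_class[OF md])
  obtain xs :: "'a list" where xs: "set xs = UNIV" "distinct xs"
    using finite_distinct_list[OF finite_UNIV] by blast
  let ?us = "map u xs :: ('a, 'k) mpoly list"
  let ?Us = "map residue_class ?us"
  have us: "set ?us \<subseteq> carrier ?R" using u_in_poly_ring by auto
  then have Us: "set ?Us \<subseteq> carrier ?Q" using h.hom_closed by auto
  have coeffs: "set (map const cs) \<subseteq> carrier ?R" for cs :: "'k list"
    using const_in_poly_ring by auto
  have hom: "h.S.combine (map residue_class (map const cs)) ?Us = residue_class (h.R.combine (map const cs) ?us)"
    for cs :: "'k list"
    by (rule h.combine_hom[OF coeffs us])
  have closed: "h.R.combine (map const cs) ?us \<in> carrier ?R" for cs :: "'k list"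
    by (rule h.R.combine_in_carrier[OF coeffs us])
  \<comment> \<open>This element gives the monomial 1, whose coordinate shows that the quotient is
    not the zero ring.\<close>
  obtain bot :: 'a where bot: "S bot = {}"
    using simplicial_complex_range_S[OF md] unfolding simplicial_complex_on_def by (metis rangeE)
  have "residue_class (1 :: ('a, 'k) mpoly) \<noteq> residue_class 0"
  proof
    assume "residue_class (1 :: ('a, 'k) mpoly) = residue_class 0"
    then have "Poly_Mapping.lookup (1 :: ('a, 'k) mpoly) (exponents (S bot)) = 0"
      using residue_class_eq_iff[OF md, of "1 :: ('a, 'k) mpoly" 0] h.R.one_closed h.R.zero_closed
      by (simp add: poly_ring_simps)
    then show False by (simp add: bot exponents_def)
  qed
  then have "\<one>\<^bsub>?Q\<^esub> \<noteq> \<zero>\<^bsub>?Q\<^esub>"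
    using h.hom_one h.hom_zero by (simp add: poly_ring_simps)
  then have sub: "subfield scalars ?Q"
    unfolding scalars_def by (rule h.img_is_subfield(2)[OF subfield_range_const])
  have ex_consts: "\<exists>cs. Ks = map residue_class (map const cs)"
    if "set Ks \<subseteq> (scalars :: ('a, 'k) mpoly set set)" for Ks
    using that
  proof (induction Ks)
    case (Cons K Ks)
    then obtain c cs where "K = residue_class (const c)" "Ks = map residue_class (map const cs)"
      unfolding scalars_def by auto
    then have "K # Ks = map residue_class (map const (c # cs))" by simp
    then show ?case by (rule exI)
  qed simp
  have "h.S.independent scalars ?Us"
  proof (rule h.S.trivial_combine_imp_independent[OF sub Us])
    fix Ks assume Ks: "set Ks \<subseteq> (scalars :: ('a, 'k) mpoly set set)" and zero: "h.S.combine Ks ?Us = \<zero>\<^bsub>?Q\<^esub>"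
    obtain cs where cs: "Ks = map residue_class (map const cs)" using ex_consts[OF Ks] by blast
    have "residue_class (h.R.combine (map const cs) ?us) = residue_class 0"
      using zero hom[of cs] h.hom_zero unfolding cs by (simp add: poly_ring_simps)
    then have vanish: "Poly_Mapping.lookup (h.R.combine (map const cs) ?us) (exponents (S a)) = 0" for a
      using residue_class_eq_iff[OF md closed[of cs], of 0] h.R.zero_closed by (simp add: poly_ring_simps)
    have "cs ! i = 0" if "i < length xs" "i < length cs" for i
      using lookup_combine_u(2)[OF xs(2) that] vanish by simp
    then have "set (take (length xs) cs) \<subseteq> {0}" by (auto simp: in_set_conv_nth)
    \<comment> \<open>The list of scalars may be longer than the basis; only scalars paired with a
      basis element must vanish.\<close>
    then have "set (take (length ?Us) Ks) \<subseteq> {residue_class (const 0)}"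
      unfolding cs by (auto simp: take_map)
    then show "set (take (length ?Us) Ks) \<subseteq> {\<zero>\<^bsub>?Q\<^esub>}"
      using h.hom_zero by (simp add: poly_ring_simps const_def)
  qed
  moreover have "h.S.Span scalars ?Us = carrier ?Q"
  proof
    show "h.S.Span scalars ?Us \<subseteq> carrier ?Q"
      using h.S.Span_in_carrier[OF _ Us] subfieldE(3)[OF sub] by blast
    show "carrier ?Q \<subseteq> h.S.Span scalars ?Us"
    proof
      fix X assume "X \<in> carrier ?Q"
      then obtain f where f: "f \<in> carrier ?R" "X = residue_class f" unfolding carrier_quotient_ring by blast
      \<comment> \<open>The coordinates of \<open>f\<close>, in the order of
        \<open>xs\<close>.\<close>
      define cs where "cs = map (\<lambda>a. Poly_Mapping.lookup f (exponents (S a))) xs"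
      have "Poly_Mapping.lookup (h.R.combine (map const cs) ?us) (exponents (S a))
          = Poly_Mapping.lookup f (exponents (S a))" for a
      proof -
        obtain i where i: "i < length xs" "a = xs ! i" using xs(1) by (metis UNIV_I in_set_conv_nth)
        then show ?thesis using lookup_combine_u(2)[OF xs(2), of i cs] by (simp add: cs_def)
      qed
      then have "X = h.S.combine (map residue_class (map const cs)) ?Us"
        unfolding f(2) hom using residue_class_eq_iff[OF md f(1) closed] by simp
      moreover have "set (map residue_class (map const cs)) \<subseteq> (scalars :: ('a, 'k) mpoly set set)"
        unfolding scalars_def by auto
      ultimately show "X \<in> h.S.Span scalars ?Us"
        unfolding h.S.Span_eq_combine_set[OF sub Us] by blast
    qed
  qed
  moreover have "distinct ?Us"
    using xs(2) inj_residue_class_u[OF md] by (auto simp: distinct_map comp_def inj_on_def)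
  moreover have "set ?Us = (\<lambda>a. residue_class (u a)) ` UNIV"
    using xs(1) by (simp add: image_image)
  ultimately show ?thesis unfolding is_finite_basis_def by blast
qed


text \<open>Injectivity is stated separately because the basis is given as a set: it excludes
  coincidences among the residue classes.\<close>

theorem theorem3p3:
  assumes "meet_distributive TYPE('a::{finite, semilattice_inf})"
  shows "inj (\<lambda>a::'a. residue_class (u a :: ('a, 'k::field) mpoly)) \<and>
    is_finite_basis (quotient_ring :: ('a, 'k) mpoly set ring) scalars
      ((\<lambda>a. residue_class (u a)) ` UNIV) \<and>
    simplicial_complex_on (join_irreducibles :: 'a set) (range S) \<and>
    (\<forall>i. int (f_number (range (S :: 'a \<Rightarrow> 'a set)) i) =
         h_number (alexander_dual :: ('a + 'a) set set) i)"
  using inj_residue_class_u[OF assms] is_finite_basis_residue_class_u[OF assms]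
    simplicial_complex_range_S[OF assms] h_number_alexander_dual[OF assms]
  by simp

end
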